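(* Let $k\ge1$, let $\boldsymbol{\lambda}=(\lambda_1,\dots,\lambda_k)$ with all $\lambda_i>0$, and let $\Lambda=\operatorname{diag}(\lambda_1,\dots,\lambda_k)$. The generalized helicoid $\mathcal{H}_{\boldsymbol{\lambda}}\subset\mathbb{R}^{2k+1}$ is an entire graph over a $(k+1)$-plane if and only if there exists a matrix $B\in\mathbb{R}^{k\times k}$ such that $$\det\big(\cos(\Lambda s)+B\sin(\Lambda s)\big)>0\qquad\text{for all }s\in\mathbb{R}.$$
   Context: $\mathcal{H}_{\boldsymbol{\lambda}}$ is the image of $F_{\boldsymbol{\lambda}}:\mathbb{R}^k\times\mathbb{R}\to\mathbb{R}^k\times\mathbb{R}^k\times\mathbb{R}=\mathbb{R}^{2k+1}$, $F_{\boldsymbol{\lambda}}(u,s)=(\cos(\Lambda s)u,\ \sin(\Lambda s)u,\ s)$, where $\cos(\Lambda s)=\operatorname{diag}(\cos\lambda_1s,\dots,\cos\lambda_ks)$ and $\sin(\Lambda s)=\operatorname{diag}(\sin\lambda_1s,\dots,\sin\lambda_ks)$. $\mathcal{H}_{\boldsymbol{\lambda}}$ is an entire graph over a $(k+1)$-plane if there is a $(k+1)$-dimensional linear subspace $\Pi\subset\mathbb{R}^{2k+1}$ such that, with $P_\Pi$ the orthogonal projection onto $\Pi$, the map $P_\Pi\circ F_{\boldsymbol{\lambda}}:\mathbb{R}^k\times\mathbb{R}\to\Pi$ is a global diffeomorphism. *)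

theory Defs
  imports "HOL-Analysis.Analysis"
begin

text \<open>
  \<open>Ck_on n f U\<close> is meant for open \<open>U\<close>: all iterated directional derivatives of \<open>f\<close> of order
  at most \<open>n\<close> exist (as values of Frechet derivatives) and are continuous on \<open>U\<close>.
\<close>

primrec Ck_on ::
  "nat \<Rightarrow> ('a::euclidean_space \<Rightarrow> 'b::euclidean_space) \<Rightarrow> 'a set \<Rightarrow> bool" where
  "Ck_on 0 f U \<longleftrightarrow> continuous_on U f"
| "Ck_on (Suc n) f U \<longleftrightarrow>
     (\<forall>x\<in>U. f differentiable (at x)) \<and>
     (\<forall>v. Ck_on n (\<lambda>x. frechet_derivative f (at x) v) U)"

text \<open>
  Smoothness on an arbitrary subset of a Euclidean space: local extendability to a
  \<open>C\<^sup>\<infinity>\<close> map on an open neighbourhood.  For a linear subspace this agrees with smoothness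
  in linear coordinates on the subspace.
\<close>

definition smooth_map_on ::
  "'a::euclidean_space set \<Rightarrow> ('a \<Rightarrow> 'b::euclidean_space) \<Rightarrow> bool" where
  "smooth_map_on S f \<longleftrightarrow>
     (\<forall>x\<in>S. \<exists>U g. open U \<and> x \<in> U \<and> (\<forall>n. Ck_on n g U) \<and> (\<forall>y\<in>S \<inter> U. g y = f y))"

definition diffeomorphism_between ::
  "'a::euclidean_space set \<Rightarrow> 'b::euclidean_space set \<Rightarrow> ('a \<Rightarrow> 'b) \<Rightarrow> bool" where
  "diffeomorphism_between S T f \<longleftrightarrow>
     bij_betw f S T \<and> smooth_map_on S f \<and> smooth_map_on T (inv_into S f)"

definition orth_proj :: "'a::euclidean_space set \<Rightarrow> 'a \<Rightarrow> 'a" where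
  "orth_proj V x = (THE p. p \<in> V \<and> (\<forall>w\<in>V. orthogonal (x - p) w))"

lemma orth_proj_exists_unique:
  fixes V :: "'a::euclidean_space set"
  assumes "subspace V"
  shows "\<exists>!p. p \<in> V \<and> (\<forall>w\<in>V. orthogonal (x - p) w)"
proof -
  obtain y z where yz: "y \<in> span V" "\<And>w. w \<in> span V \<Longrightarrow> orthogonal z w" "x = y + z"
    using orthogonal_subspace_decomp_exists[of V x] by metis
  have sp: "span V = V" using assms by simp
  show ?thesis
  proof (rule ex1I[of _ y])
    show "y \<in> V \<and> (\<forall>w\<in>V. orthogonal (x - y) w)" using yz sp by auto
  next
    fix p assume p: "p \<in> V \<and> (\<forall>w\<in>V. orthogonal (x - p) w)"
    have d: "y - p \<in> V" using p yz(1) sp assms by (simp add: subspace_diff)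
    have "orthogonal (x - p) (y - p)" "orthogonal (x - y) (y - p)"
      using p d yz sp by auto
    then have "(y - p) \<bullet> (y - p) = 0"
      by (simp add: orthogonal_def inner_diff_left inner_diff_right)
    then show "p = y" by simp
  qed
qed

definition diag_matrix :: "real ^ 'k \<Rightarrow> real ^ 'k ^ 'k" where
  "diag_matrix d = (\<chi> i j. if i = j then d $ i else 0)"

definition cos_matrix :: "real ^ 'k \<Rightarrow> real \<Rightarrow> real ^ 'k ^ 'k" where
  "cos_matrix lam s = diag_matrix (\<chi> i. cos (lam $ i * s))"

definition sin_matrix :: "real ^ 'k \<Rightarrow> real \<Rightarrow> real ^ 'k ^ 'k" where
  "sin_matrix lam s = diag_matrix (\<chi> i. sin (lam $ i * s))"

text \<open>
  The ambient space of dimension \<open>2k + 1\<close> is the product type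
  \<open>real ^ 'k \<times> real ^ 'k \<times> real\<close> with its Euclidean inner product, where \<open>k = CARD('k)\<close>.
\<close>

definition helicoid_map ::
  "real ^ 'k \<Rightarrow> (real ^ 'k) \<times> real \<Rightarrow> (real ^ 'k) \<times> (real ^ 'k) \<times> real" where
  "helicoid_map lam = (\<lambda>(u, s). (cos_matrix lam s *v u, sin_matrix lam s *v u, s))"

text \<open>
  The generalized helicoid is the range of \<^term>\<open>helicoid_map lam\<close>; being an entire graph over
  a \<open>(k + 1)\<close>-plane is by definition a condition on this parametrization.
\<close>

definition helicoid_entire_graph :: "real ^ 'k \<Rightarrow> bool" where
  "helicoid_entire_graph lam \<longleftrightarrow>
     (\<exists>V :: ((real ^ 'k) \<times> (real ^ 'k) \<times> real) set.
        subspace V \<and> dim V = CARD('k) + 1 \<and>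
        diffeomorphism_between UNIV V (orth_proj V \<circ> helicoid_map lam))"

end

theory Submission
  imports Defs
begin

text \<open>
  Suppose \<open>A \<circ> F\<close> is a diffeomorphism, where \<open>A\<close> is the projection onto \<open>V\<close>.  Its derivative at
  \<open>(u, 0)\<close> sends \<open>(h, t)\<close> to \<open>A (h, t \<Lambda> u, t)\<close>.  As this is injective for every \<open>u\<close>, comparing
  dimensions gives \<open>A (0, y, 0) = A (B y, 0, 0)\<close> for some matrix \<open>B\<close>.  Injectivity at \<open>(0, s)\<close> then
  says that \<open>cos (\<Lambda> s) + B sin (\<Lambda> s)\<close> is invertible, and its determinant is \<open>1\<close> at \<open>s = 0\<close>.
  Conversely, given \<open>B\<close>, project along \<open>{(- B y, y, 0)}\<close>, that is, onto
  \<open>V = {(a, B\<^sup>T a, s)}\<close>; the inverse map is smooth by Cramer's rule.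
\<close>

section \<open>Calculus of \<open>Ck_on\<close>\<close>

text \<open>A derivative at a point of an open set sees only nearby values, so functions that agree
  on \<open>U\<close> have the same derivatives there, and the agreement passes to every higher
  order.\<close>

lemma Ck_on_cong:
  assumes "open U" "\<And>x. x \<in> U \<Longrightarrow> f x = g x"
  shows "Ck_on n f U \<longleftrightarrow> Ck_on n g U"
  using assms(2)
proof (induction n arbitrary: f g)
  case 0
  then show ?case by (simp cong: continuous_on_cong)
next
  case (Suc n)
  have *: "(f has_derivative D) (at x) \<longleftrightarrow> (g has_derivative D) (at x)" if "x \<in> U" for D x
    using Suc.prems that assms(1)
    by (metis has_derivative_transform_within_open)
  have "Ck_on n (\<lambda>x. frechet_derivative f (at x) v) U
      \<longleftrightarrow> Ck_on n (\<lambda>x. frechet_derivative g (at x) v) U" for v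
    by (rule Suc.IH) (simp add: frechet_derivative_def *)
  then show ?case
    by (auto simp: differentiable_def *)
qed

text \<open>\<open>frechet_derivative\<close> is given by a choice operator. Uniqueness of
  derivatives lets an explicit formula valid on \<open>U\<close> take its place; the inductions
  below on the order of smoothness rest on this.\<close>

lemma Ck_on_SucI:
  assumes "open U" "\<And>x. x \<in> U \<Longrightarrow> (f has_derivative f' x) (at x)"
    and "\<And>v. Ck_on n (\<lambda>x. f' x v) U"
  shows "Ck_on (Suc n) f U"
proof -
  have "Ck_on n (\<lambda>x. frechet_derivative f (at x) v) U" for v
    using Ck_on_cong[OF assms(1), of "\<lambda>x. frechet_derivative f (at x) v" "\<lambda>x. f' x v" n]
      assms(2,3) frechet_derivative_at by metis
  then show ?thesis
    using assms(2) by (auto simp: differentiable_def)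
qed

lemma Ck_on_SucD:
  assumes "Ck_on (Suc n) f U"
  shows "x \<in> U \<Longrightarrow> (f has_derivative frechet_derivative f (at x)) (at x)"
    and "Ck_on n (\<lambda>x. frechet_derivative f (at x) v) U"
  using assms frechet_derivative_works by auto

text \<open>The derivative of a product, a reciprocal, a cosine or a sine contains undifferentiated
  factors again; this supplies their smoothness of the lower order in those inductions.\<close>

lemma Ck_on_Suc_imp: "Ck_on (Suc n) f U \<Longrightarrow> Ck_on n f U"
proof (induction n arbitrary: f)
  case 0
  then show ?case
    by (auto intro!: continuous_at_imp_continuous_on differentiable_imp_continuous_within)
next
  case (Suc n)
  from Suc.prems have "\<forall>x\<in>U. f differentiable (at x)"
    "\<And>v. Ck_on (Suc n) (\<lambda>x. frechet_derivative f (at x) v) U"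
    by auto
  with Suc.IH show ?case by simp
qed

lemma Ck_on_const: "open U \<Longrightarrow> Ck_on n (\<lambda>x. c) U"
proof (induction n arbitrary: c)
  case (Suc n)
  show ?case
    by (rule Ck_on_SucI[where f' = "\<lambda>x v. 0"]) (use Suc in auto)
qed simp

lemma Ck_on_bounded_linear:
  assumes "open U" "bounded_linear L" shows "Ck_on n L U"
proof (cases n)
  case (Suc m)
  show ?thesis unfolding Suc
    by (rule Ck_on_SucI[where f' = "\<lambda>x. L"])
      (use assms in \<open>auto intro: bounded_linear_imp_has_derivative Ck_on_const\<close>)
qed (use assms in \<open>auto intro: linear_continuous_on\<close>)

lemma Ck_on_bounded_linear_compose:
  assumes "open U" "bounded_linear L" "Ck_on n f U"
  shows "Ck_on n (\<lambda>x. L (f x)) U"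
  using assms(3)
proof (induction n arbitrary: f)
  case 0
  then show ?case using assms(2) by (auto intro: bounded_linear.continuous_on)
next
  case (Suc n)
  show ?case
    by (rule Ck_on_SucI[where f' = "\<lambda>x v. L (frechet_derivative f (at x) v)"])
      (use assms(1,2) Suc.IH Ck_on_SucD[OF Suc.prems] in
        \<open>auto intro: bounded_linear.has_derivative\<close>)
qed

lemma Ck_on_add:
  assumes "open U" "Ck_on n f U" "Ck_on n g U"
  shows "Ck_on n (\<lambda>x. f x + g x) U"
  using assms(2,3)
proof (induction n arbitrary: f g)
  case 0
  then show ?case by (auto intro: continuous_intros)
next
  case (Suc n)
  note D = Ck_on_SucD[OF Suc.prems(1)] Ck_on_SucD[OF Suc.prems(2)]
  show ?case
    by (rule Ck_on_SucI[where
          f' = "\<lambda>x v. frechet_derivative f (at x) v + frechet_derivative g (at x) v"])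
      (use assms(1) Suc.IH D in \<open>auto intro: has_derivative_add\<close>)
qed

lemma Ck_on_sum:
  assumes "open U" "\<And>i. i \<in> I \<Longrightarrow> Ck_on n (f i) U"
  shows "Ck_on n (\<lambda>x. \<Sum>i\<in>I. f i x) U"
  using assms
  by (induction I rule: infinite_finite_induct) (auto intro: Ck_on_const Ck_on_add)

lemma Ck_on_mult:
  fixes f g :: "'a::euclidean_space \<Rightarrow> real"
  assumes "open U" "Ck_on n f U" "Ck_on n g U"
  shows "Ck_on n (\<lambda>x. f x * g x) U"
  using assms(2,3)
proof (induction n arbitrary: f g)
  case 0
  then show ?case by (auto intro: continuous_intros)
next
  case (Suc n)
  note D = Ck_on_SucD[OF Suc.prems(1)] Ck_on_SucD[OF Suc.prems(2)]
  show ?case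
    by (rule Ck_on_SucI[where
          f' = "\<lambda>x v. f x * frechet_derivative g (at x) v + frechet_derivative f (at x) v * g x"])
      (use assms(1) Suc.IH D Suc.prems[THEN Ck_on_Suc_imp] in
        \<open>auto intro: has_derivative_mult Ck_on_add\<close>)
qed

lemma Ck_on_prod:
  fixes f :: "'i \<Rightarrow> 'a::euclidean_space \<Rightarrow> real"
  assumes "open U" "\<And>i. i \<in> I \<Longrightarrow> Ck_on n (f i) U"
  shows "Ck_on n (\<lambda>x. \<Prod>i\<in>I. f i x) U"
  using assms
  by (induction I rule: infinite_finite_induct) (auto intro: Ck_on_const Ck_on_mult)

text \<open>The derivative of \<open>1 / f\<close> is a product of \<open>1 / f\<close> taken twice
  and a derivative of \<open>f\<close>, so the induction hypothesis and the product rule close the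
  step.\<close>

lemma Ck_on_inverse:
  fixes f :: "'a::euclidean_space \<Rightarrow> real"
  assumes "open U" "Ck_on n f U" "\<And>x. x \<in> U \<Longrightarrow> f x \<noteq> 0"
  shows "Ck_on n (\<lambda>x. inverse (f x)) U"
  using assms(2)
proof (induction n)
  case 0
  then show ?case using assms(3) by (auto intro: continuous_on_inverse)
next
  case (Suc n)
  note D = Ck_on_SucD[OF Suc.prems]
  have IH: "Ck_on n (\<lambda>x. inverse (f x)) U"
    using Suc by (blast intro: Ck_on_Suc_imp)
  show ?case
  proof (rule Ck_on_SucI[OF assms(1)])
    \<comment> \<open>The sign is written as a constant factor so that the rules for products and
      constants apply directly.\<close>
    show "((\<lambda>x. inverse (f x)) has_derivative (\<lambda>v. - 1 *
        (inverse (f x) * frechet_derivative f (at x) v * inverse (f x)))) (at x)"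
      if "x \<in> U" for x
      using Deriv.has_derivative_inverse[OF assms(3)[OF that] D(1)[OF that]] by simp
  qed (intro Ck_on_mult Ck_on_const assms(1) D(2) IH)
qed

lemma Ck_on_divide:
  fixes f g :: "'a::euclidean_space \<Rightarrow> real"
  assumes "open U" "Ck_on n f U" "Ck_on n g U" "\<And>x. x \<in> U \<Longrightarrow> g x \<noteq> 0"
  shows "Ck_on n (\<lambda>x. f x / g x) U"
  using assms by (simp add: divide_inverse Ck_on_mult Ck_on_inverse)

text \<open>Each function appears in the derivative of the other, hence a simultaneous
  induction.\<close>

lemma Ck_on_cos_sin:
  fixes f :: "'a::euclidean_space \<Rightarrow> real"
  assumes "open U" "Ck_on n f U"
  shows "Ck_on n (\<lambda>x. cos (f x)) U \<and> Ck_on n (\<lambda>x. sin (f x)) U"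
  using assms(2)
proof (induction n)
  case 0
  then show ?case by (auto intro: continuous_intros)
next
  case (Suc n)
  note D = Ck_on_SucD[OF Suc.prems]
  have IH: "Ck_on n (\<lambda>x. cos (f x)) U" "Ck_on n (\<lambda>x. sin (f x)) U"
    using Suc by (auto dest: Ck_on_Suc_imp simp del: Ck_on.simps)
  have "Ck_on (Suc n) (\<lambda>x. cos (f x)) U"
  proof (rule Ck_on_SucI[OF assms(1)])
    show "((\<lambda>x. cos (f x)) has_derivative
        (\<lambda>v. frechet_derivative f (at x) v * (- 1 * sin (f x)))) (at x)" if "x \<in> U" for x
      using has_derivative_cos[OF D(1)[OF that]] by (simp add: mult.commute)
  qed (intro Ck_on_mult Ck_on_const assms(1) D(2) IH)
  moreover have "Ck_on (Suc n) (\<lambda>x. sin (f x)) U"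
  proof (rule Ck_on_SucI[OF assms(1)])
    show "((\<lambda>x. sin (f x)) has_derivative
        (\<lambda>v. frechet_derivative f (at x) v * cos (f x))) (at x)" if "x \<in> U" for x
      using has_derivative_sin[OF D(1)[OF that]] by (simp add: mult.commute)
  qed (intro Ck_on_mult assms(1) D(2) IH)
  ultimately show ?case ..
qed

lemma Ck_on_cos:
  fixes f :: "'a::euclidean_space \<Rightarrow> real"
  shows "open U \<Longrightarrow> Ck_on n f U \<Longrightarrow> Ck_on n (\<lambda>x. cos (f x)) U"
  using Ck_on_cos_sin by blast

lemma Ck_on_sin:
  fixes f :: "'a::euclidean_space \<Rightarrow> real"
  shows "open U \<Longrightarrow> Ck_on n f U \<Longrightarrow> Ck_on n (\<lambda>x. sin (f x)) U"
  using Ck_on_cos_sin by blast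

lemma Ck_on_Pair:
  assumes "open U" "Ck_on n f U" "Ck_on n g U"
  shows "Ck_on n (\<lambda>x. (f x, g x)) U"
proof -
  have "bounded_linear (\<lambda>a. (a, 0))" "bounded_linear (\<lambda>b. (0, b))"
    by (intro bounded_linear_Pair bounded_linear_ident bounded_linear_zero)+
  from this[THEN Ck_on_bounded_linear_compose[OF assms(1)]]
  have "Ck_on n (\<lambda>x. (f x, 0) + (0, g x)) U"
    using assms by (intro Ck_on_add)
  then show ?thesis by simp
qed

lemma Ck_on_vec_nth:
  assumes "open U" "Ck_on n f U"
  shows "Ck_on n (\<lambda>x. f x $ i) U"
  using Ck_on_bounded_linear_compose[OF assms(1) bounded_linear_vec_nth assms(2)] .

lemma Ck_on_vec_lambda:
  fixes f :: "'i::finite \<Rightarrow> 'a::euclidean_space \<Rightarrow> real"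
  assumes "open U" "\<And>i. Ck_on n (f i) U"
  shows "Ck_on n (\<lambda>x. \<chi> i. f i x) U"
proof -
  have "Ck_on n (\<lambda>x. \<Sum>i\<in>UNIV. f i x *\<^sub>R axis i 1) U"
    using assms
    by (intro Ck_on_sum Ck_on_bounded_linear_compose[OF _ bounded_linear_scaleR_left])
  also have "(\<lambda>x. \<Sum>i\<in>UNIV. f i x *\<^sub>R axis i 1) = (\<lambda>x. \<chi> i. f i x)"
    by (simp add: fun_eq_iff vec_eq_iff axis_def if_distrib cong: if_cong)
  finally show ?thesis .
qed

lemma Ck_on_matrix_vector_mult:
  fixes A :: "'a::euclidean_space \<Rightarrow> real ^ 'm ^ 'n"
  assumes "open U" "\<And>i j. Ck_on n (\<lambda>x. A x $ i $ j) U" "Ck_on n f U"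
  shows "Ck_on n (\<lambda>x. A x *v f x) U"
  unfolding matrix_vector_mult_def
  by (intro Ck_on_vec_lambda Ck_on_sum Ck_on_mult Ck_on_vec_nth assms)

lemma Ck_on_det:
  fixes A :: "'a::euclidean_space \<Rightarrow> real ^ 'n ^ 'n"
  assumes "open U" "\<And>i j. Ck_on n (\<lambda>x. A x $ i $ j) U"
  shows "Ck_on n (\<lambda>x. det (A x)) U"
  unfolding det_def
  by (intro Ck_on_sum Ck_on_mult Ck_on_prod Ck_on_const assms)

lemma smooth_map_onI:
  assumes "\<And>n. Ck_on n g UNIV" "\<And>x. x \<in> S \<Longrightarrow> g x = f x"
  shows "smooth_map_on S f"
  unfolding smooth_map_on_def using assms by blast

text \<open>The inverse lives on \<open>V\<close> alone, where no Frechet derivative is available.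
  Its local smooth extension \<open>g\<close> satisfies \<open>g (f z) = z\<close> for
  \<open>z\<close> near \<open>x\<close>, and the chain rule then gives the derivative of
  \<open>f\<close> a left inverse.\<close>

lemma diffeomorphism_between_derivative_inj:
  assumes diff: "diffeomorphism_between UNIV V f"
    and f': "(f has_derivative f') (at x)" and "f' v = 0"
  shows "v = 0"
proof -
  have bij: "bij_betw f UNIV V" and smooth: "smooth_map_on V (inv f)"
    using diff by (auto simp: diffeomorphism_between_def)
  have fV: "f z \<in> V" for z using bij by (auto simp: bij_betw_def)
  obtain U g where U: "open U" "f x \<in> U" and g: "Ck_on (Suc 0) g U"
    and eq: "\<And>y. y \<in> V \<inter> U \<Longrightarrow> g y = inv f y"
    using smooth fV unfolding smooth_map_on_def by meson
  obtain g' where g': "(g has_derivative g') (at (f x))"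
    using Ck_on_SucD(1)[OF g U(2)] by blast
  have "((g \<circ> f) has_derivative (g' \<circ> f')) (at x)"
    using diff_chain_at[OF f' g'] .
  \<comment> \<open>By continuity \<open>f z\<close> stays in \<open>U\<close>, and it always lies
    in \<open>V\<close>, so \<open>g\<close> acts on it as the inverse of \<open>f\<close>.\<close>
  moreover have "eventually (\<lambda>z. (g \<circ> f) z = z) (at x)"
  proof -
    have "eventually (\<lambda>z. f z \<in> U) (at x)"
      using has_derivative_continuous[OF f'] U
      by (auto simp: continuous_within intro: topological_tendstoD)
    then show ?thesis
      by eventually_elim (use eq fV bij in \<open>auto simp: bij_betw_def\<close>)
  qed
  moreover have "(g \<circ> f) x = x" using eq fV U bij by (auto simp: bij_betw_def)
  ultimately have "((\<lambda>z. z) has_derivative (g' \<circ> f')) (at x)"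
    using has_derivative_transform_eventually by fastforce
  then have "g' \<circ> f' = (\<lambda>z. z)"
    using has_derivative_unique has_derivative_ident by blast
  then have "v = g' (f' v)" by (metis comp_apply)
  also have "\<dots> = 0"
    using has_derivative_bounded_linear[OF g'] \<open>f' v = 0\<close>
    by (simp add: linear_0 bounded_linear.linear)
  finally show ?thesis .
qed

section \<open>Orthogonal projections\<close>

lemma orth_proj_eqI:
  assumes "subspace V" "p \<in> V" "\<And>w. w \<in> V \<Longrightarrow> orthogonal (x - p) w"
  shows "orth_proj V x = p"
  unfolding orth_proj_def
  using the1_equality[OF orth_proj_exists_unique[OF assms(1)]] assms(2,3) by blast

lemma
  assumes "subspace V"
  shows orth_proj_in: "orth_proj V x \<in> V"
    and orth_proj_orthogonal: "w \<in> V \<Longrightarrow> orthogonal (x - orth_proj V x) w"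
  using theI'[OF orth_proj_exists_unique[OF assms, of x]] unfolding orth_proj_def by blast+

lemma linear_orth_proj:
  assumes "subspace V" shows "linear (orth_proj V)"
proof (rule linearI)
  show "orth_proj V (x + y) = orth_proj V x + orth_proj V y" for x y
  proof (rule orth_proj_eqI[OF assms])
    show "orthogonal (x + y - (orth_proj V x + orth_proj V y)) w" if "w \<in> V" for w
      using orth_proj_orthogonal[OF assms that, of x] orth_proj_orthogonal[OF assms that, of y]
      by (simp add: orthogonal_def algebra_simps)
  qed (simp add: assms orth_proj_in subspace_add)
  show "orth_proj V (c *\<^sub>R x) = c *\<^sub>R orth_proj V x" for c x
  proof (rule orth_proj_eqI[OF assms])
    show "orthogonal (c *\<^sub>R x - c *\<^sub>R orth_proj V x) w" if "w \<in> V" for w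
      using orth_proj_orthogonal[OF assms that, of x]
      by (simp add: orthogonal_def flip: scaleR_diff_right)
  qed (simp add: assms orth_proj_in subspace_scale)
qed

section \<open>The generalized helicoid\<close>

lemma cos_matrix_mult: "cos_matrix lam s *v u = (\<chi> i. cos (lam $ i * s) * u $ i)"
  by (simp add: cos_matrix_def diag_matrix_def matrix_vector_mult_def if_distrib[of "\<lambda>a. a * _"]
      cong: if_cong)

lemma sin_matrix_mult: "sin_matrix lam s *v u = (\<chi> i. sin (lam $ i * s) * u $ i)"
  by (simp add: sin_matrix_def diag_matrix_def matrix_vector_mult_def if_distrib[of "\<lambda>a. a * _"]
      cong: if_cong)

lemma Ck_on_cos_plus_sin_matrix:
  assumes "open U" "Ck_on n s U"
  shows "Ck_on n (\<lambda>x. (cos_matrix lam (s x) + B ** sin_matrix lam (s x)) $ i $ j) U"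
proof -
  \<comment> \<open>The case distinction becomes a constant factor, which leaves sums and products
    that the closure rules can handle.\<close>
  have "(cos_matrix lam t + B ** sin_matrix lam t) $ i $ j =
      (if i = j then 1 else 0) * cos (lam $ i * t) + B $ i $ j * sin (lam $ j * t)" for t
    by (simp add: cos_matrix_def sin_matrix_def diag_matrix_def matrix_matrix_mult_def
        if_distrib cong: if_cong)
  then show ?thesis
    by (simp only:) (intro Ck_on_add Ck_on_mult Ck_on_const Ck_on_cos Ck_on_sin assms)
qed

lemma Ck_on_helicoid_map: "Ck_on n (helicoid_map lam) UNIV"
proof -
  have s: "Ck_on n (\<lambda>p::(real ^ 'a) \<times> real. lam $ i * snd p) UNIV" for i
    by (intro Ck_on_mult Ck_on_const Ck_on_bounded_linear bounded_linear_snd open_UNIV)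
  have u: "Ck_on n (\<lambda>p::(real ^ 'a) \<times> real. fst p $ i) UNIV" for i
    by (intro Ck_on_vec_nth Ck_on_bounded_linear bounded_linear_fst open_UNIV)
  show ?thesis
    unfolding helicoid_map_def case_prod_beta cos_matrix_mult sin_matrix_mult
    by (intro Ck_on_Pair Ck_on_vec_lambda Ck_on_mult Ck_on_cos Ck_on_sin s u
        Ck_on_bounded_linear bounded_linear_snd open_UNIV)
qed

lemma has_derivative_vec_lambda:
  fixes f :: "'a::real_normed_vector \<Rightarrow> 'i::finite \<Rightarrow> real"
  assumes "\<And>i. ((\<lambda>x. f x i) has_derivative (\<lambda>v. f' v i)) F"
  shows "((\<lambda>x. \<chi> i. f x i) has_derivative (\<lambda>v. \<chi> i. f' v i)) F"
proof -
  have *: "(\<chi> i. h i) = (\<Sum>i\<in>UNIV. h i *\<^sub>R axis i 1)" for h :: "'i \<Rightarrow> real"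
    by (simp add: vec_eq_iff axis_def if_distrib cong: if_cong)
  show ?thesis
    unfolding * by (intro has_derivative_sum has_derivative_scaleR_left assms)
qed

lemma has_derivative_helicoid_map:
  "(helicoid_map lam has_derivative
     (\<lambda>(h, t). (\<chi> i. cos (lam $ i * s) * h $ i - sin (lam $ i * s) * (lam $ i * t) * u $ i,
                \<chi> i. sin (lam $ i * s) * h $ i + cos (lam $ i * s) * (lam $ i * t) * u $ i,
                t))) (at (u, s))"
  unfolding helicoid_map_def case_prod_beta cos_matrix_mult sin_matrix_mult
  by (intro has_derivative_Pair has_derivative_vec_lambda)
    (auto intro!: derivative_eq_intros bounded_linear.has_derivative[OF bounded_linear_vec_nth]
      simp: algebra_simps)

section \<open>Necessity of the determinant condition\<close>

lemma entire_graph_imp_det_pos: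
  fixes lam :: "real ^ 'k"
  assumes lam: "\<And>i. lam $ i > 0" and "helicoid_entire_graph lam"
  shows "\<exists>B :: real ^ 'k ^ 'k. \<forall>s. det (cos_matrix lam s + B ** sin_matrix lam s) > 0"
proof -
  obtain V where V: "subspace V" "dim V = CARD('k) + 1"
    and diff: "diffeomorphism_between UNIV V (orth_proj V \<circ> helicoid_map lam)"
    using assms(2) unfolding helicoid_entire_graph_def by blast
  define A where "A = orth_proj V"
  have A: "linear A" unfolding A_def using V(1) by (rule linear_orth_proj)
  have AV: "A x \<in> V" for x unfolding A_def using V(1) by (rule orth_proj_in)
  have inj: "h = 0 \<and> t = 0" if
    "A (\<chi> i. cos (lam $ i * s) * h $ i - sin (lam $ i * s) * (lam $ i * t) * u $ i,
        \<chi> i. sin (lam $ i * s) * h $ i + cos (lam $ i * s) * (lam $ i * t) * u $ i, t) = 0"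
    for h t u s
  proof -
    have "((A \<circ> helicoid_map lam) has_derivative A \<circ>
     (\<lambda>(h, t). (\<chi> i. cos (lam $ i * s) * h $ i - sin (lam $ i * s) * (lam $ i * t) * u $ i,
                \<chi> i. sin (lam $ i * s) * h $ i + cos (lam $ i * s) * (lam $ i * t) * u $ i,
                t))) (at (u, s))"
      by (intro diff_chain_at has_derivative_helicoid_map linear_imp_has_derivative A)
    from diffeomorphism_between_derivative_inj[OF diff[folded A_def] this, of "(h, t)"] that
    show ?thesis by (simp add: zero_prod_def)
  qed
  have injM: "x = 0" if "A (x, 0, 0) = 0" for x
    using inj[of 0 x 0 0] that by (simp add: zero_vec_def)
  \<comment> \<open>At \<open>s = 0\<close> the direction \<open>(x, 1)\<close> has image
    \<open>(x, Lambda u, 1)\<close>. Since every \<open>lam $ i\<close> is nonzero, \<open>u\<close>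
    can be chosen with \<open>Lambda u = y\<close>, so all these vectors are tangent to the
    helicoid.\<close>
  have transv: "A (x, y, 1) \<noteq> 0" for x y
  proof
    assume "A (x, y, 1) = 0"
    moreover have "lam $ i \<noteq> 0" for i using lam[of i] by simp
    ultimately show False
      using inj[of 0 x 1 "\<chi> i. y $ i / lam $ i"] by simp
  qed
  \<comment> \<open>Here the base point is \<open>(0, s)\<close> and the direction is horizontal, so
    no term from differentiating the rotation survives.\<close>
  have injL: "x = 0" if "A (cos_matrix lam s *v x, sin_matrix lam s *v x, 0) = 0" for s x
    using inj[of s x 0 0] that by (simp add: cos_matrix_mult sin_matrix_mult)

  have "\<exists>x. A (- x, y, 0) = 0" for y
  proof -
    \<comment> \<open>The restriction of \<open>A\<close> to the (k+1)-dimensional space where the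
      middle component vanishes. It is injective, and its image lies in \<open>V\<close>, which has
      the same dimension, so it maps onto \<open>V\<close>.\<close>
    define Q where "Q = (\<lambda>p::(real ^ 'k) \<times> real. A (fst p, 0, snd p))"
    have Q: "linear Q"
      unfolding Q_def
      by (rule linear_compose[OF _ A, unfolded o_def]) (auto intro!: linearI)
    have scale: "c *\<^sub>R A (a, b, t) = A (c *\<^sub>R a, c *\<^sub>R b, c * t)" for c a b t
      using linear_cmul[OF A, of c "(a, b, t)"] by simp
    \<comment> \<open>A kernel vector with \<open>t\<close> nonzero could be rescaled to last
      component 1, against \<open>transv\<close>.\<close>
    have t0: "t = 0" if "A (x, z, t) = 0" for x z t
      using transv[of "(1 / t) *\<^sub>R x" "(1 / t) *\<^sub>R z"] scale[of "1 / t" x z t] that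
      by (cases "t = 0") auto
    have "inj Q"
      unfolding linear_injective_0[OF Q]
    proof (intro allI impI)
      fix p assume "Q p = 0"
      then have "A (fst p, 0, snd p) = 0" by (simp add: Q_def)
      with t0[OF this] injM[of "fst p"] show "p = 0" by (simp add: prod_eq_iff)
    qed
    then have "dim (range Q) = CARD('k) + 1"
      using dim_image_eq[OF Q, of UNIV] by (simp add: dim_UNIV)
    then have "range Q = V"
      using subspace_dim_equal[of "range Q" V] V AV linear_subspace_image[OF Q subspace_UNIV]
      by (auto simp: Q_def)
    then obtain x t where "A (0, y, 0) = A (x, 0, t)"
      using AV[of "(0, y, 0)"] by (auto simp: Q_def)
    then have "A (- x, y, - t) = 0"
      using linear_diff[OF A, of "(0, y, 0)" "(x, 0, t)"] by simp
    with t0[OF this] show ?thesis by auto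
  qed
  then obtain b where b: "\<And>y. A (- b y, y, 0) = 0" by metis
  \<comment> \<open>The function \<open>b\<close> comes from pointwise choice and is not known to be
    linear. Only its values on the standard basis are kept, as columns of \<open>B\<close>;
    linearity of \<open>A\<close> extends the kernel relation to all \<open>y\<close>.\<close>
  define B :: "real ^ 'k ^ 'k" where "B = (\<chi> i j. b (axis j 1) $ i)"
  have AB: "A (x, y, 0) = A (x + B *v y, 0, 0)" for x y
  proof -
    have "(- (B *v y), y, 0 :: real) = (\<Sum>j\<in>UNIV. y $ j *\<^sub>R (- b (axis j 1), axis j 1, 0))"
      by (simp add: prod_eq_iff fst_sum snd_sum vec_eq_iff B_def matrix_vector_mult_def axis_def
          sum_negf mult.commute if_distrib cong: if_cong)
    then have "A (- (B *v y), y, 0) = 0"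
      by (simp only:) (simp add: linear_sum[OF A] linear_cmul[OF A] b del: scaleR_Pair)
    then show ?thesis
      using linear_add[OF A, of "(x + B *v y, 0, 0)" "(- (B *v y), y, 0)"] by simp
  qed
  let ?d = "\<lambda>s. det (cos_matrix lam s + B ** sin_matrix lam s)"
  have nz: "?d s \<noteq> 0" for s
  proof -
    have "x = 0" if "(cos_matrix lam s + B ** sin_matrix lam s) *v x = 0" for x
      using injL[of s x] that AB[of "cos_matrix lam s *v x" "sin_matrix lam s *v x"] linear_0[OF A]
      by (simp add: matrix_vector_mult_add_rdistrib matrix_vector_mul_assoc zero_prod_def)
    then show ?thesis
      using matrix_left_invertible_ker invertible_det_nz invertible_left_inverse by metis
  qed
  have "Ck_on 0 ?d UNIV"
    by (intro Ck_on_det Ck_on_cos_plus_sin_matrix Ck_on_bounded_linear bounded_linear_ident open_UNIV)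
  then have cont: "continuous_on UNIV ?d" by simp
  have "cos_matrix lam 0 = mat 1" "sin_matrix lam 0 = 0"
    by (simp_all add: cos_matrix_def sin_matrix_def diag_matrix_def mat_def vec_eq_iff)
  then have d0: "?d 0 = 1" by (simp add: matrix_matrix_mult_def zero_vec_def[symmetric])
  \<comment> \<open>A continuous function on the line without zeros keeps its sign, and its value at
    0 is 1.\<close>
  have "?d s > 0" for s
  proof (rule ccontr)
    assume "\<not> ?thesis"
    then have "?d s \<le> 0" "0 \<le> ?d 0" using d0 by auto
    moreover have "connected (range ?d)"
      using cont connected_UNIV by (rule connected_continuous_image)
    ultimately have "0 \<in> range ?d"
      by (meson connectedD_interval rangeI)
    then show False using nz by auto
  qed
  then show ?thesis by blast
qed

section \<open>Sufficiency of the determinant condition\<close>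

lemma det_pos_imp_entire_graph:
  fixes lam :: "real ^ 'k" and B :: "real ^ 'k ^ 'k"
  assumes "\<And>s. det (cos_matrix lam s + B ** sin_matrix lam s) > 0"
  shows "helicoid_entire_graph lam"
proof -
  define T where "T = (\<lambda>s. cos_matrix lam s + B ** sin_matrix lam s)"
  have nz: "det (T s) \<noteq> 0" for s using assms[of s] by (simp add: T_def)
  \<comment> \<open>A linear parametrization of the orthogonal complement of the vectors
    \<open>(- B y, y, 0)\<close>.\<close>
  define J where "J = (\<lambda>(a::real ^ 'k, s::real). (a, transpose B *v a, s))"
  have J: "linear J"
    unfolding J_def
    by (auto intro!: linearI simp: matrix_vector_right_distrib matrix_vector_mult_scaleR
        simp del: transpose_matrix_vector)
  have "inj J" by (auto simp: J_def inj_on_def)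
  define V where "V = range J"
  have V: "subspace V" "dim V = CARD('k) + 1"
    unfolding V_def using linear_subspace_image[OF J subspace_UNIV]
      dim_image_eq[OF J, of UNIV] \<open>inj J\<close> by (auto simp: dim_UNIV)
  \<comment> \<open>The Gram matrix of \<open>J\<close> in its first argument: it appears in the
    normal equations for projecting onto \<open>V\<close>. It is invertible because
    \<open>a \<bullet> (G *v a)\<close> is the sum of the squared norms of \<open>a\<close> and
    \<open>transpose B *v a\<close>.\<close>
  define G where "G = mat 1 + B ** transpose B"
  have Gmult: "G *v a = a + B *v (transpose B *v a)" for a
    by (simp add: G_def matrix_vector_mult_add_rdistrib matrix_vector_mul_assoc
        del: transpose_matrix_vector)
  have "a = 0" if "G *v a = 0" for a
  proof -
    have "0 = a \<bullet> (G *v a)" using that by simp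
    also have "\<dots> = a \<bullet> a + (transpose B *v a) \<bullet> (transpose B *v a)"
      by (simp add: Gmult inner_add_right flip: dot_lmul_matrix)
    finally show ?thesis
      using inner_ge_zero[of a] inner_ge_zero[of "transpose B *v a"]
      by (smt (verit) inner_eq_zero_iff)
  qed
  then have "invertible G"
    using matrix_left_invertible_ker invertible_left_inverse by metis
  then obtain H where H: "G ** H = mat 1" "H ** G = mat 1"
    unfolding invertible_def by blast
  define f where "f = orth_proj V \<circ> helicoid_map lam"
  \<comment> \<open>Pairing the residual of the candidate \<open>J (c, s)\<close> with
    \<open>(a, transpose B *v a, t)\<close> gives \<open>(T s *v u - G *v c) \<bullet> a\<close>. It
    vanishes for all \<open>a\<close> exactly when \<open>G *v c = T s *v u\<close>, whence
    \<open>c = H *v (T s *v u)\<close>.\<close>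
  have f: "f (u, s) = J (H *v (T s *v u), s)" for u s
    unfolding f_def o_apply
  proof (rule orth_proj_eqI[OF V(1)])
    fix w assume "w \<in> V"
    then obtain a t where w: "w = (a, transpose B *v a, t)" by (auto simp: V_def J_def)
    define c where "c = H *v (T s *v u)"
    have "G *v c = T s *v u"
      by (simp add: c_def matrix_vector_mul_assoc matrix_mul_assoc H)
    then have "(cos_matrix lam s *v u - c) + B *v (sin_matrix lam s *v u - transpose B *v c) = 0"
      unfolding T_def
      by (simp add: Gmult matrix_vector_mult_add_rdistrib matrix_vector_mul_assoc
          matrix_vector_mult_diff_distrib algebra_simps)
    moreover have "x \<bullet> (transpose B *v a) = (B *v x) \<bullet> a" for x
      by (metis dot_lmul_matrix inner_commute vector_transpose_matrix)
    ultimately show "orthogonal (helicoid_map lam (u, s) - J (c, s)) w"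
      by (simp add: w orthogonal_def helicoid_map_def J_def flip: inner_add_left)
  qed (auto simp: V_def)
  \<comment> \<open>The solution \<open>u\<close> of \<open>T s *v u = G *v a\<close> by Cramer's
    rule. Quotients of determinants make smoothness visible, and since \<open>det (T s)\<close>
    never vanishes the formula is smooth on the whole ambient space, not merely on
    \<open>V\<close>.\<close>
  define g :: "(real ^ 'k) \<times> (real ^ 'k) \<times> real \<Rightarrow> (real ^ 'k) \<times> real" where
    "g = (\<lambda>p. (\<chi> k. det (\<chi> i j. if j = k then (G *v fst p) $ i else T (snd (snd p)) $ i $ j)
        / det (T (snd (snd p))), snd (snd p)))"
  have g: "g (a, b, s) = (u, s) \<longleftrightarrow> T s *v u = G *v a" for a b s u
    using cramer[OF nz[of s], of u "G *v a"] by (auto simp: g_def cong: if_cong)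
  have gf: "g (f p) = p" for p
    by (cases p) (simp add: f J_def g matrix_vector_mul_assoc matrix_mul_assoc H)
  have fg: "f (g p) = p" if p_V: "p \<in> V" for p
  proof -
    obtain a s where p: "p = J (a, s)" using p_V by (auto simp: V_def)
    obtain u where gu: "g p = (u, s)" by (simp add: p J_def g_def)
    then have "T s *v u = G *v a" using g by (simp add: p J_def)
    then have "H *v (T s *v u) = a" by (simp add: matrix_vector_mul_assoc H)
    then show ?thesis unfolding gu f by (simp add: p)
  qed
  have fV: "f p \<in> V" for p by (cases p) (simp add: f V_def)
  have bij: "bij_betw f UNIV V"
    by (rule bij_betw_byWitness[where f' = g]) (use gf fg fV in auto)
  have "Ck_on n f UNIV" for n
    unfolding f_def o_def
    by (rule Ck_on_bounded_linear_compose[OF open_UNIV _ Ck_on_helicoid_map])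
      (use linear_orth_proj[OF V(1)] in \<open>simp add: linear_conv_bounded_linear\<close>)
  then have "smooth_map_on UNIV f"
    by (rule smooth_map_onI) (rule refl)
  moreover have "smooth_map_on V (inv f)"
  \<comment> \<open>The map \<open>g\<close> is one global smooth extension of the inverse, so a
    single neighbourhood serves every point of \<open>V\<close>.\<close>
  proof (rule smooth_map_onI[where g = g])
    fix n
    have s: "Ck_on n (\<lambda>p::(real ^ 'k) \<times> (real ^ 'k) \<times> real. snd (snd p)) UNIV"
      by (intro Ck_on_bounded_linear bounded_linear_compose[OF bounded_linear_snd bounded_linear_snd]
          open_UNIV)
    have T: "Ck_on n (\<lambda>p::(real ^ 'k) \<times> (real ^ 'k) \<times> real. T (snd (snd p)) $ i $ j) UNIV" for i j
      unfolding T_def by (intro Ck_on_cos_plus_sin_matrix s open_UNIV)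
    have a: "Ck_on n (\<lambda>p::(real ^ 'k) \<times> (real ^ 'k) \<times> real. (G *v fst p) $ i) UNIV" for i
      by (intro Ck_on_vec_nth Ck_on_matrix_vector_mult Ck_on_const Ck_on_bounded_linear
          bounded_linear_fst open_UNIV)
    have "Ck_on n (\<lambda>p::(real ^ 'k) \<times> (real ^ 'k) \<times> real.
        if j = k then (G *v fst p) $ i else T (snd (snd p)) $ i $ j) UNIV" for i j k
      by (cases "j = k") (use a T in simp_all)
    then show "Ck_on n g UNIV"
      unfolding g_def
      by (intro Ck_on_Pair Ck_on_vec_lambda Ck_on_divide Ck_on_det s T nz open_UNIV) simp
    show "g p = inv f p" if "p \<in> V" for p
      using fg[OF that] gf by (metis inv_f_f injI)
  qed
  ultimately have "diffeomorphism_between UNIV V f"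
    using bij by (simp add: diffeomorphism_between_def)
  then show ?thesis
    unfolding helicoid_entire_graph_def f_def using V by blast
qed

theorem theorem8p1:
  fixes lam :: "real ^ 'k"
  assumes "\<And>i. lam $ i > 0"
  shows "helicoid_entire_graph lam \<longleftrightarrow>
    (\<exists>B :: real ^ 'k ^ 'k. \<forall>s :: real. det (cos_matrix lam s + B ** sin_matrix lam s) > 0)"
  using entire_graph_imp_det_pos[of lam] det_pos_imp_entire_graph[of lam] assms by blast

end
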